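(* For each $n\in\{3,4,5\}$, there exist $n-1$ completely independent spanning trees in the augmented cube $AQ_n$.
   Context: All graphs are finite and undirected. Augmented cube: for an integer $n\ge 1$, the $n$-dimensional augmented cube $AQ_n$ is a graph with $2^n$ vertices, labeled by the $n$-bit binary strings $u_1u_2\cdots u_n$. It is defined recursively. $AQ_1$ is the complete graph $K_2$ with vertex set $\{0,1\}$. For $n\ge 2$, $AQ_n$ is obtained from two copies of $AQ_{n-1}$, denoted $AQ_{n-1}^0$ with vertex set $\{0u_2\cdots u_n : u_i\in\{0,1\}\}$ and $AQ_{n-1}^1$ with vertex set $\{1v_2\cdots v_n : v_i\in\{0,1\}\}$ (the label of each vertex of $AQ_{n-1}$ being prefixed by $0$, respectively $1$), by adding $2^n$ edges between them: a vertex $0u_2\cdots u_n$ is joined to a vertex $1v_2\cdots v_n$ if and only if either $u_i=v_i$ for all $2\le i\le n$, or $u_i=\overline{v_i}$ for all $2\le i\le n$, where $\overline{v_i}=1-v_i$. Completely independent spanning trees: a spanning tree of a graph $G$ is a subgraph $T$ of $G$ that is a tree with $V(T)=V(G)$. For a tree $T$ and vertices $u,v$ of $T$, let $P_T(u,v)$ be the set of vertices of the unique path between $u$ and $v$ in $T$. Two spanning trees $T_1,T_2$ of $G$ are edge-disjoint if $E(T_1)\cap E(T_2)=\emptyset$, and internally vertex disjoint if $P_{T_1}(u,v)\cap P_{T_2}(u,v)=\{u,v\}$ for every pair of vertices $u,v$ of $G$. Spanning trees $T_1,\dots,T_k$ of $G$ are completely independent if they are pairwise edge-disjoint and pairwise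 internally vertex disjoint. *)

theory Defs
  imports "Graph_Theory.Graph_Theory"
begin

text \<open>
  A finite simple undirected graph is a \<^locale>\<open>graph\<close> of the library: a finite, loopfree, symmetric
  digraph without parallel arcs, in which an edge is a pair of opposite arcs.

  The library predicates \<^const>\<open>tree\<close> and \<^const>\<open>spanning_tree\<close> rest on the absence of directed
  cycles. They are unusable for this representation, since the two arcs of a single edge already
  form a directed cycle. Cycles are therefore required to have at least three vertices here.
\<close>

definition undirected_cycle :: "('a,'b) pre_digraph \<Rightarrow> 'a list \<Rightarrow> bool" where
  "undirected_cycle G c \<longleftrightarrow> 3 \<le> length c \<and> vpath c G \<and> (last c, hd c) \<in> arcs_ends G"

definition undirected_tree :: "('a,'b) pre_digraph \<Rightarrow> bool" where
  "undirected_tree T \<longleftrightarrow> graph T \<and> connected T \<and> (\<nexists>c. undirected_cycle T c)"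

definition undirected_spanning_tree :: "('a,'b) pre_digraph \<Rightarrow> ('a,'b) pre_digraph \<Rightarrow> bool" where
  "undirected_spanning_tree T G \<longleftrightarrow> undirected_tree T \<and> spanning T G"

definition tree_path :: "('a,'b) pre_digraph \<Rightarrow> 'a \<Rightarrow> 'a \<Rightarrow> 'a list" where
  "tree_path T u v = (THE p. vpath p T \<and> hd p = u \<and> last p = v)"

definition path_verts :: "('a,'b) pre_digraph \<Rightarrow> 'a \<Rightarrow> 'a \<Rightarrow> 'a set" where
  "path_verts T u v = set (tree_path T u v)"

text \<open>
  As the arc sets of symmetric subgraphs of a graph are closed under reversal, disjointness of the
  arc sets is disjointness of the sets of undirected edges.
\<close>

definition edge_disjoint :: "('a,'b) pre_digraph \<Rightarrow> ('a,'b) pre_digraph \<Rightarrow> bool" where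
  "edge_disjoint T\<^sub>1 T\<^sub>2 \<longleftrightarrow> arcs T\<^sub>1 \<inter> arcs T\<^sub>2 = {}"

definition internally_vertex_disjoint ::
    "('a,'b) pre_digraph \<Rightarrow> ('a,'b) pre_digraph \<Rightarrow> ('a,'b) pre_digraph \<Rightarrow> bool" where
  "internally_vertex_disjoint G T\<^sub>1 T\<^sub>2 \<longleftrightarrow>
     (\<forall>u\<in>verts G. \<forall>v\<in>verts G. path_verts T\<^sub>1 u v \<inter> path_verts T\<^sub>2 u v = {u, v})"

definition completely_independent_spanning_trees ::
    "('a,'b) pre_digraph \<Rightarrow> nat \<Rightarrow> (nat \<Rightarrow> ('a,'b) pre_digraph) \<Rightarrow> bool" where
  "completely_independent_spanning_trees G k T \<longleftrightarrow>
     (\<forall>i\<in>{1..k}. undirected_spanning_tree (T i) G) \<and>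
     (\<forall>i\<in>{1..k}. \<forall>j\<in>{1..k}. i \<noteq> j \<longrightarrow>
        edge_disjoint (T i) (T j) \<and> internally_vertex_disjoint G (T i) (T j))"

text \<open>
  A binary string is a \<^typ>\<open>bool list\<close> with the first bit at the head. The augmented cube is defined
  for dimension at least 1; the value at dimension 0 is a dummy.
\<close>

fun augmented_cube :: "nat \<Rightarrow> bool list pair_pre_digraph" where
  "augmented_cube 0 = \<lparr> pverts = {[]}, parcs = {} \<rparr>"
| "augmented_cube (Suc 0) =
     \<lparr> pverts = {[False], [True]}, parcs = {([False], [True]), ([True], [False])} \<rparr>"
| "augmented_cube (Suc (Suc n)) =
     (let G = augmented_cube (Suc n) in
      \<lparr> pverts = {b # u | b u. u \<in> pverts G},
        parcs = {(b # u, b # v) | b u v. (u, v) \<in> parcs G} \<union>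
                {(b # u, (\<not> b) # v) | b u v. u \<in> pverts G \<and> v \<in> pverts G \<and>
                   (u = v \<or> u = map Not v)} \<rparr>)"

lemma pverts_augmented_cube: "pverts (augmented_cube n) = {u. length u = n}"
proof (induction n rule: augmented_cube.induct)
  case 2
  show ?case by (auto simp: length_Suc_conv)
next
  case (3 n)
  then show ?case by (auto simp: Let_def length_Suc_conv)
qed auto

lemma card_pverts_augmented_cube: "card (pverts (augmented_cube n)) = 2 ^ n"
  using card_lists_length_eq[of "UNIV :: bool set" n] by (simp add: pverts_augmented_cube)

lemma parcs_augmented_cube:
  "(u, v) \<in> parcs (augmented_cube n) \<Longrightarrow>
     u \<in> pverts (augmented_cube n) \<and> v \<in> pverts (augmented_cube n) \<and> u \<noteq> v \<and>
     (v, u) \<in> parcs (augmented_cube n)"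
proof (induction n arbitrary: u v rule: augmented_cube.induct)
  case (3 n)
  have *: "x = map Not y \<longleftrightarrow> y = map Not x" for x y :: "bool list"
    by (auto simp: comp_def)
  show ?case
  proof -
    let ?G = "augmented_cube (Suc n)"
    from "3.prems" consider
        b x y where "u = b # x" "v = b # y" "(x, y) \<in> parcs ?G"
      | b x y where "u = b # x" "v = (\<not> b) # y" "x \<in> pverts ?G" "y \<in> pverts ?G"
          "x = y \<or> x = map Not y"
      by (auto simp: Let_def)
    then show ?thesis
    proof cases
      case 1
      then show ?thesis using "3.IH"[of x y] by (simp add: Let_def)
    next
      case 2
      then have "y = x \<or> y = map Not x" using * by blast
      with 2 show ?thesis by (auto simp: Let_def)
    qed
  qed
qed auto

lemma graph_augmented_cube: "graph (with_proj (augmented_cube n))"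
proof -
  have fin: "finite (pverts (augmented_cube n))"
    using card_pverts_augmented_cube[of n] by (intro card_ge_0_finite) simp
  have "parcs (augmented_cube n) \<subseteq> pverts (augmented_cube n) \<times> pverts (augmented_cube n)"
    using parcs_augmented_cube by fast
  then have fin': "finite (parcs (augmented_cube n))"
    using fin by (blast intro: finite_subset)
  show ?thesis
    by unfold_locales
      (auto simp: fin fin' symmetric_def arc_to_ends_def dest: parcs_augmented_cube intro!: symI)
qed

end

theory Submission
  imports Defs
begin

text \<open>
  A rooted spanning tree is the same thing as a parent map: a self-map of the vertex set whose
  iterates carry every vertex to one fixed point, the root. Interior vertices of a path in the tree
  are parents of other vertices of the path, because at most one of the two neighbours on the path
  is the parent of the vertex, and the other is then its child. Hence two trees are internally vertex disjoint as
  soon as no vertex is a parent in both, and this also forbids a common edge, except an edge whose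
  ends are each other's parents, in one tree each. So completely independent spanning trees come from
  a colouring of the vertices and, for every colour \<open>i\<close>, a parent map \<open>p\<^sub>i\<close> with values in
  colour class \<open>i\<close>, such that \<open>p\<^sub>j (p\<^sub>i v) \<noteq> v\<close> for \<open>i \<noteq> j\<close> (lemma \<open>cist_of_parent_maps\<close>).
  Such maps exist exactly when the classes induce connected subgraphs and the edges between
  any two classes can be oriented so that every vertex has an edge leaving it.

  For the augmented cube the colour classes are chosen by the moves between neighbours: an edge flips
  either a single bit or all bits from some position on. Every class is connected by the
  moves that preserve the colour. Between two classes, the moves that change one colour into the
  other are shared out: vertices of one class use some of the edges, vertices of the other class use
  different ones. In dimension 3 the classes are the two cosets of a linear subspace. In dimension 4
  there are four such cosets, two of which are merged. In dimension 5 the classes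
  are translates of each other, but not cosets: the colour is a pair of bits, the second of which is
  read off in a way that depends on the first coordinate of the vertex.
\<close>

section \<open>Trees given by parent maps\<close>

definition parent_tree :: "'a set \<Rightarrow> ('a \<Rightarrow> 'a) \<Rightarrow> 'a pair_pre_digraph" where
  "parent_tree V p =
     \<lparr> pverts = V, parcs = {(u, v). u \<in> V \<and> v \<in> V \<and> u \<noteq> v \<and> (v = p u \<or> u = p v)} \<rparr>"

lemma pverts_parent_tree [simp]: "pverts (parent_tree V p) = V"
  by (simp add: parent_tree_def)

lemma parcs_parent_tree [simp]:
  "(u, v) \<in> parcs (parent_tree V p) \<longleftrightarrow> u \<in> V \<and> v \<in> V \<and> u \<noteq> v \<and> (v = p u \<or> u = p v)"
  by (simp add: parent_tree_def)

text \<open>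
  The root is marked by being its own parent, so that no separate case is needed for it.
\<close>
locale parent_map =
  fixes V :: "'a set" and r :: 'a and p :: "'a \<Rightarrow> 'a"
  assumes finite_V: "finite V"
    and root_in: "r \<in> V"
    and root_fixed: "p r = r"
    and closed: "v \<in> V \<Longrightarrow> p v \<in> V"
    and climbs: "v \<in> V \<Longrightarrow> \<exists>k. (p ^^ k) v = r"
begin

abbreviation T :: "('a, 'a \<times> 'a) pre_digraph" where
  "T \<equiv> with_proj (parent_tree V p)"

lemma graph_T: "graph T"
proof -
  have "parcs (parent_tree V p) \<subseteq> V \<times> V"
    by auto
  then have "finite (parcs (parent_tree V p))"
    using finite_V by (blast intro: finite_subset)
  then show ?thesis
    by unfold_locales
      (auto simp: finite_V symmetric_def arc_to_ends_def intro!: symI)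
qed

sublocale graph T
  by (rule graph_T)

lemma reachable_root: "(p ^^ k) v = r \<Longrightarrow> v \<in> V \<Longrightarrow> v \<rightarrow>\<^sup>*\<^bsub>T\<^esub> r"
proof (induction k arbitrary: v)
  case 0
  then show ?case by simp
next
  case (Suc k)
  then have *: "p v \<rightarrow>\<^sup>*\<^bsub>T\<^esub> r"
    by (simp add: closed funpow_swap1)
  show ?case
  proof (cases "p v = v")
    case False
    then have "v \<rightarrow>\<^bsub>T\<^esub> p v"
      using Suc.prems closed by simp
    from this * show ?thesis by (rule adj_reachable_trans)
  qed (use * in simp)
qed

lemma reachable_T: "u \<in> V \<Longrightarrow> v \<in> V \<Longrightarrow> u \<rightarrow>\<^sup>*\<^bsub>T\<^esub> v"
  using reachable_trans[OF reachable_root symmetric_reachable'[OF reachable_root]] climbs by blast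

lemma connected_T: "connected T"
  unfolding connected_def
  using root_in reachable_T by (auto intro!: strongly_connectedI reachable_mk_symmetricI)

definition depth :: "'a \<Rightarrow> nat" where
  "depth v = (LEAST k. (p ^^ k) v = r)"

lemma depth_parent_less:
  assumes "v \<in> V" "p v \<noteq> v"
  shows "depth (p v) < depth v"
proof -
  have at: "(p ^^ depth v) v = r"
    unfolding depth_def using climbs[OF assms(1)] by (rule LeastI_ex)
  have "v \<noteq> r"
    using assms(2) root_fixed by auto
  with at obtain m where m: "depth v = Suc m"
    by (cases "depth v") auto
  with at have "(p ^^ m) (p v) = r"
    by (simp add: funpow_swap1)
  then have "depth (p v) \<le> m"
    unfolding depth_def by (rule Least_le)
  with m show ?thesis by simp
qed

text \<open>
  The two neighbours of the vertex on the path are distinct, so one of them is not its parent.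
\<close>
lemma interior_has_child:
  assumes q: "vpath q T" and x: "x \<in> set q" "x \<noteq> hd q" "x \<noteq> last q"
  shows "\<exists>w \<in> set q. p w = x \<and> w \<noteq> x"
proof -
  obtain xs ys where split: "q = xs @ x # ys"
    using x(1) by (meson split_list)
  have ne: "xs \<noteq> []" "ys \<noteq> []"
    using x split by auto
  let ?y = "last xs" and ?z = "hd ys"
  have "set (vwalk_arcs q) \<subseteq> arcs_ends T" and dist: "distinct q"
    using q by (auto simp: vpath_def vwalk_def)
  then have "(?y, x) \<in> arcs_ends T" "(x, ?z) \<in> arcs_ends T"
    using ne by (auto simp: split vwalk_arcs_append)
  moreover have "?y \<in> set xs" "?z \<in> set ys"
    using ne by auto
  moreover from this have "?y \<noteq> ?z" "?y \<in> set q" "?z \<in> set q"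
    using dist by (auto simp: split)
  ultimately show ?thesis
    by simp metis
qed

text \<open>
  A vertex of maximal depth on a path has no child on it, so it is an end of the path.
\<close>
lemma depth_le_ends:
  assumes q: "vpath q T" and x: "x \<in> set q"
  shows "depth x \<le> max (depth (hd q)) (depth (last q))"
proof -
  define m where "m = Max (depth ` set q)"
  have le: "depth y \<le> m" if "y \<in> set q" for y
    using that by (simp add: m_def)
  have "m \<in> depth ` set q"
    unfolding m_def using x by (intro Max_in) auto
  then obtain y where y: "y \<in> set q" "depth y = m" by auto
  have "y = hd q \<or> y = last q"
  proof (rule ccontr)
    assume "\<not> ?thesis"
    then obtain w where w: "w \<in> set q" "p w = y" "w \<noteq> y"
      using interior_has_child[OF q y(1)] by auto
    moreover have "w \<in> V"
      using q w(1) by (auto simp: vpath_def vwalk_def)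
    ultimately have "depth y < depth w"
      using depth_parent_less[of w] by auto
    with le[OF w(1)] y(2) show False by simp
  qed
  with le[OF x] y(2) show ?thesis by auto
qed

text \<open>
  From its deeper end a path cannot descend to a child, which would be deeper than both ends. This
  determines its first step, and thereby, from both ends inwards, the whole path.
\<close>
lemma path_starts_with_parent:
  assumes q: "vpath q T" and ne: "hd q \<noteq> last q" and deep: "depth (last q) \<le> depth (hd q)"
  shows "\<exists>q'. q = hd q # q' \<and> vpath q' T \<and> hd q' = p (hd q) \<and> last q' = last q"
proof -
  from q have "q \<noteq> []" by auto
  with ne obtain u y q' where eq: "q = u # y # q'"
    by (metis last.simps list.exhaust list.sel(1))
  have adj: "(u, y) \<in> arcs_ends T" and q': "vpath (y # q') T"
    using q by (auto simp: eq vpath_def vwalk_def)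
  have "depth y \<le> depth u"
    using depth_le_ends[OF q, of y] deep by (simp add: eq)
  then have "y = p u"
    using adj depth_parent_less[of y] by fastforce
  then show ?thesis
    using q' by (intro exI[of _ "y # q'"]) (simp add: eq)
qed

lemma vpath_rev: "vpath q T \<Longrightarrow> vpath (rev q) T"
  using vwalk_rev_ex[OF sym_arcs] by (auto simp: vpath_def)

lemma path_unique:
  assumes "vpath q T" "vpath q' T" "hd q = hd q'" "last q = last q'"
  shows "q = q'"
  using assms
proof (induction "length q" arbitrary: q q' rule: less_induct)
  case less
  note q = \<open>vpath q T\<close> and q' = \<open>vpath q' T\<close>
  have nonempty: "q \<noteq> []" "q' \<noteq> []" using q q' by auto
  consider "hd q = last q" | "hd q \<noteq> last q" "depth (last q) \<le> depth (hd q)"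
    | "hd q \<noteq> last q" "depth (hd q) \<le> depth (last q)"
    by linarith
  then show ?case
  proof cases
    case 1
    have "s = [hd s]" if "vpath s T" "hd s = last s" for s
      using that by (cases s) (auto simp: vpath_def split: if_splits)
    with 1 less.prems show ?thesis by metis
  next
    case 2
    obtain t where t: "q = hd q # t" "vpath t T" "hd t = p (hd q)" "last t = last q"
      using path_starts_with_parent[OF q] 2 by blast
    obtain t' where t': "q' = hd q # t'" "vpath t' T" "hd t' = p (hd q)" "last t' = last q"
      using path_starts_with_parent[OF q'] 2 less.prems by metis
    have "length t < length q" by (subst t(1)) simp
    then have "t = t'"
      using less.hyps t t' by metis
    with t(1) t'(1) show ?thesis by metis
  next
    case 3
    obtain t where t: "rev q = last q # t" "vpath t T" "hd t = p (last q)" "last t = hd q"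
      using path_starts_with_parent[OF vpath_rev[OF q]] 3 nonempty
      by (auto simp: hd_rev last_rev)
    obtain t' where t': "rev q' = last q # t'" "vpath t' T" "hd t' = p (last q)" "last t' = hd q"
      using path_starts_with_parent[OF vpath_rev[OF q']] 3 nonempty less.prems
      by (auto simp: hd_rev last_rev)
    have "length (rev q) = Suc (length t)" by (subst t(1)) simp
    then have "length t < length q" by simp
    then have "t = t'"
      using less.hyps t t' by metis
    with t(1) t'(1) have "rev q = rev q'" by metis
    then show ?thesis by simp
  qed
qed

lemma vpath_pair: "(u, v) \<in> arcs_ends T \<Longrightarrow> vpath [u, v] T"
  by (simp add: vpath_def vwalk_def)

text \<open>
  A cycle would be a second path between the ends of its closing edge.
\<close>
lemma no_undirected_cycle: "\<not> undirected_cycle T c"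
proof
  assume "undirected_cycle T c"
  then have len: "3 \<le> length c" and path: "vpath c T" and adj: "(last c, hd c) \<in> arcs_ends T"
    by (simp_all only: undirected_cycle_def)
  have "vpath [hd c, last c] T"
    by (rule vpath_pair[OF graph_symmetric[OF adj]])
  from path_unique[OF path this] have "c = [hd c, last c]"
    by (simp only: list.sel last.simps list.distinct if_False if_True simp_thms)
  then have "length c = length [hd c, last c]"
    by (rule arg_cong)
  with len show False by simp
qed

lemma undirected_tree_T: "undirected_tree T"
  by (simp only: undirected_tree_def graph_T connected_T no_undirected_cycle simp_thms)

lemma tree_path:
  assumes "u \<in> V" "v \<in> V"
  shows "vpath (tree_path T u v) T" "hd (tree_path T u v) = u" "last (tree_path T u v) = v"
proof -
  obtain q where "vpath q T \<and> hd q = u \<and> last q = v"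
    using reachable_T[OF assms] reachable_vpath_conv by metis
  then have "\<exists>!q. vpath q T \<and> hd q = u \<and> last q = v"
    using path_unique by metis
  from theI'[OF this]
  show "vpath (tree_path T u v) T" "hd (tree_path T u v) = u" "last (tree_path T u v) = v"
    unfolding tree_path_def by auto
qed

lemma ends_in_path_verts:
  assumes "u \<in> V" "v \<in> V"
  shows "{u, v} \<subseteq> path_verts T u v"
proof -
  have "tree_path T u v \<noteq> []"
    using tree_path(1)[OF assms] by auto
  then show ?thesis
    using tree_path(2,3)[OF assms] hd_in_set last_in_set unfolding path_verts_def by fastforce
qed

lemma path_verts_subset:
  assumes "u \<in> V" "v \<in> V"
  shows "path_verts T u v \<subseteq> {u, v} \<union> p ` V"
proof
  fix x assume x: "x \<in> path_verts T u v"
  note path = tree_path[OF assms]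
  show "x \<in> {u, v} \<union> p ` V"
  proof (cases "x = u \<or> x = v")
    case False
    then obtain w where "w \<in> set (tree_path T u v)" "p w = x"
      using interior_has_child[OF path(1)] x path(2,3) by (auto simp: path_verts_def)
    moreover have "set (tree_path T u v) \<subseteq> V"
      using path(1) by (auto simp: vpath_def vwalk_def)
    ultimately show ?thesis by auto
  qed auto
qed

end

text \<open>
  Interior vertices of paths in tree \<open>i\<close> have colour \<open>i\<close>, which gives vertex disjointness. An edge common
  to the trees \<open>i\<close> and \<open>j\<close> joins a vertex to its parent in both. If the same end is the child in both
  trees, the parents coincide although their colours differ; otherwise each end is the parent of the
  other, which \<open>no_return\<close> forbids.
\<close>
lemma cist_of_parent_maps:
  fixes G :: "'a pair_pre_digraph" and p :: "'i \<Rightarrow> 'a \<Rightarrow> 'a" and colour :: "'a \<Rightarrow> 'i"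
  assumes G: "wf_digraph (with_proj G)" "symmetric (with_proj G)"
    and I: "finite I"
    and maps: "\<And>i. i \<in> I \<Longrightarrow> parent_map (pverts G) (r i) (p i)"
    and adj: "\<And>i v. i \<in> I \<Longrightarrow> v \<in> pverts G \<Longrightarrow> p i v \<noteq> v \<Longrightarrow> (v, p i v) \<in> parcs G"
    and colour: "\<And>i v. i \<in> I \<Longrightarrow> v \<in> pverts G \<Longrightarrow> colour (p i v) = i"
    and no_return: "\<And>i j v. i \<in> I \<Longrightarrow> j \<in> I \<Longrightarrow> i \<noteq> j \<Longrightarrow> v \<in> pverts G \<Longrightarrow> p j (p i v) \<noteq> v"
  shows "\<exists>T. completely_independent_spanning_trees (with_proj G) (card I) T"
proof -
  let ?V = "pverts G"
  define S where "S i = with_proj (parent_tree ?V (p i))" for i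
  have tree: "undirected_spanning_tree (S i) (with_proj G)" if i: "i \<in> I" for i
  proof -
    interpret parent_map ?V "r i" "p i" by (rule maps[OF i])
    have sym: "(u, v) \<in> parcs G" if "(v, u) \<in> parcs G" for u v
      using arcs_ends_symmetric[OF G(2)] that by simp
    have "parcs (parent_tree ?V (p i)) \<subseteq> parcs G"
      using adj[OF i] by (fastforce intro: sym)
    then have "spanning T (with_proj G)"
      using G(1) wf_digraph_axioms
      by (auto simp: spanning_def subgraph_def)
    then show ?thesis
      using undirected_tree_T by (simp add: undirected_spanning_tree_def S_def)
  qed
  have edge: "edge_disjoint (S i) (S j)" if ij: "i \<in> I" "j \<in> I" "i \<noteq> j" for i j
  proof -
    have "p i v \<noteq> p j v" if "v \<in> ?V" for v
      using colour[OF ij(1) that] colour[OF ij(2) that] ij(3) by metis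
    moreover have "p j (p i v) \<noteq> v" "p i (p j v) \<noteq> v" if "v \<in> ?V" for v
      using no_return[OF ij that] no_return[OF ij(2,1) _ that] ij(3) by auto
    ultimately show ?thesis
      by (fastforce simp: edge_disjoint_def S_def)
  qed
  have vertex: "internally_vertex_disjoint (with_proj G) (S i) (S j)"
    if ij: "i \<in> I" "j \<in> I" "i \<noteq> j" for i j
    unfolding internally_vertex_disjoint_def
  proof (intro ballI)
    fix u v assume "u \<in> verts (with_proj G)" "v \<in> verts (with_proj G)"
    then have uv: "u \<in> ?V" "v \<in> ?V" by auto
    have "x \<in> {u, v}" if x: "x \<in> path_verts (S i) u v" "x \<in> path_verts (S j) u v" for x
    proof (rule ccontr)
      assume "x \<notin> {u, v}"
      then have "x \<in> p i ` ?V" "x \<in> p j ` ?V"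
        using subsetD[OF parent_map.path_verts_subset[OF maps[OF ij(1)] uv]]
          subsetD[OF parent_map.path_verts_subset[OF maps[OF ij(2)] uv]] x
        unfolding S_def by (metis Un_iff)+
      then have "colour x = i" "colour x = j"
        using colour ij by auto
      with ij(3) show False by simp
    qed
    then have "path_verts (S i) u v \<inter> path_verts (S j) u v \<subseteq> {u, v}"
      by (intro subsetI) (elim IntE)
    moreover have "{u, v} \<subseteq> path_verts (S i) u v \<inter> path_verts (S j) u v"
      unfolding S_def
      by (rule Int_greatest[OF parent_map.ends_in_path_verts[OF maps[OF ij(1)] uv]
          parent_map.ends_in_path_verts[OF maps[OF ij(2)] uv]])
    ultimately show "path_verts (S i) u v \<inter> path_verts (S j) u v = {u, v}"
      by (rule subset_antisym)
  qed
  obtain h where h: "bij_betw h {1..card I} I"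
    using ex_bij_betw_nat_finite_1[OF I] by blast
  then have mem: "h k \<in> I" if "k \<in> {1..card I}" for k
    using that by (auto simp: bij_betw_def)
  have inj: "h k \<noteq> h l" if "k \<in> {1..card I}" "l \<in> {1..card I}" "k \<noteq> l" for k l
    using inj_onD[OF bij_betw_imp_inj_on[OF h]] that by blast
  have "completely_independent_spanning_trees (with_proj G) (card I) (S \<circ> h)"
    unfolding completely_independent_spanning_trees_def
    by (intro conjI ballI impI) (simp_all only: comp_apply tree edge vertex mem inj not_False_eq_True)
  then show ?thesis by (rule exI[where x = "S \<circ> h"])
qed

section \<open>Adjacency in the augmented cube\<close>

text \<open>
  After a common prefix, two neighbours differ either in one bit only or in all remaining bits; the
  two alternatives coincide when the first difference is in the last bit.
\<close>
fun cube_adj :: "bool list \<Rightarrow> bool list \<Rightarrow> bool" where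
  "cube_adj (a # u) (b # v) \<longleftrightarrow> (if a = b then cube_adj u v else u = v \<or> u = map Not v)"
| "cube_adj _ _ \<longleftrightarrow> False"

lemma parcs_augmented_cube_iff:
  "(u, v) \<in> parcs (augmented_cube n) \<longleftrightarrow> length u = n \<and> length v = n \<and> cube_adj u v"
proof (induction n arbitrary: u v rule: augmented_cube.induct)
  case 1
  show ?case by auto
next
  case 2
  show ?case by (auto simp: length_Suc_conv split: if_splits)
next
  case (3 n)
  show ?case
  proof (cases u; cases v)
    fix a x b y
    assume "u = a # x" "v = b # y"
    then show ?thesis
      by (auto simp: Let_def "3.IH" pverts_augmented_cube)
  qed (auto simp: Let_def)
qed

section \<open>Parent maps in dimensions 3, 4 and 5\<close>

text \<open>
  The root may depend on the colour, but the number \<open>m\<close> of steps to reach it is uniform: a vertex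
  that arrives early stays at the root.
\<close>
lemma augmented_cube_cist:
  fixes p :: "'i \<Rightarrow> bool list \<Rightarrow> bool list"
  assumes "finite I"
    and vertex: "\<And>i v. i \<in> I \<Longrightarrow> length v = n \<Longrightarrow>
      length (p i v) = n \<and> colour (p i v) = i \<and> (p i v = v \<or> cube_adj v (p i v)) \<and>
      (p i ^^ m) v = r i"
    and root: "\<And>i. i \<in> I \<Longrightarrow> length (r i) = n \<and> p i (r i) = r i"
    and no_return: "\<And>i j v. i \<in> I \<Longrightarrow> j \<in> I \<Longrightarrow> i \<noteq> j \<Longrightarrow> length v = n \<Longrightarrow> p j (p i v) \<noteq> v"
  shows "\<exists>T. completely_independent_spanning_trees (with_proj (augmented_cube n)) (card I) T"
proof (rule cist_of_parent_maps[where p = p and r = r and colour = colour])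
  interpret graph "with_proj (augmented_cube n)" by (rule graph_augmented_cube)
  show "wf_digraph (with_proj (augmented_cube n))" "symmetric (with_proj (augmented_cube n))"
    using wf_digraph_axioms sym_arcs by auto
  show "parent_map (pverts (augmented_cube n)) (r i) (p i)" if "i \<in> I" for i
  proof
    show "finite (pverts (augmented_cube n))"
      using finite_verts by simp
  qed (use that vertex root in \<open>auto simp: pverts_augmented_cube\<close>)
qed (use assms in \<open>auto simp: pverts_augmented_cube parcs_augmented_cube_iff\<close>)

fun colour3 :: "bool list \<Rightarrow> bool" where
  "colour3 [a, b, c] = b"
| "colour3 _ = undefined"

text \<open>
  Each class is a 4-cycle formed by the first and the last bit. The two classes are joined by flipping
  the middle bit, which tree \<open>False\<close> uses, and by flipping the last two bits, which tree \<open>True\<close> uses.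
\<close>
fun parent3 :: "bool \<Rightarrow> bool list \<Rightarrow> bool list" where
  "parent3 i [a, b, c] =
     (if b \<noteq> i then (if i then [a, \<not> b, \<not> c] else [a, \<not> b, c])
      else if a then [False, b, c] else [a, b, False])"
| "parent3 i v = v"

lemma augmented_cube_3_cist:
  "\<exists>T. completely_independent_spanning_trees (with_proj (augmented_cube 3)) 2 T"
proof -
  have "\<exists>T. completely_independent_spanning_trees (with_proj (augmented_cube 3))
    (card (UNIV :: bool set)) T"
  proof (rule augmented_cube_cist[where p = parent3 and colour = colour3 and m = 3
        and r = "\<lambda>i. [False, i, False]"], goal_cases)
    case (2 i v)
    then obtain a b c where "v = [a, b, c]"
      by (auto simp: numeral_eq_Suc length_Suc_conv)
    then show ?case
      by (cases i; cases a; cases b; cases c; simp add: numeral_eq_Suc)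
  next
    case (4 i j v)
    then obtain a b c where "v = [a, b, c]"
      by (auto simp: numeral_eq_Suc length_Suc_conv)
    with 4 show ?case
      by (cases i; cases j; cases b; cases c; simp)
  qed auto
  then show ?thesis by simp
qed

fun colour4 :: "bool list \<Rightarrow> nat" where
  "colour4 [a, b, c, d] = (if a \<noteq> b then 2 else if a \<noteq> d then 1 else 0)"
| "colour4 _ = undefined"

text \<open>
  Flipping \<open>c\<close> and complementing the whole string preserve the colour; they make classes 0 and 1
  into 4-cycles, and together with flipping \<open>d\<close> they connect class 2. Classes 0 and 1 are joined by
  flipping \<open>d\<close>, which tree 0 uses, and by flipping \<open>c\<close> and \<open>d\<close>, which tree 1 uses. Vertices
  outside class 2 enter it by flipping the last three bits, whereas vertices of class 2 leave it by
  flipping \<open>a\<close> or \<open>b\<close> alone; of these two moves one leads to class 0 and the other to class 1.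
\<close>
fun parent4 :: "nat \<Rightarrow> bool list \<Rightarrow> bool list" where
  "parent4 i [a, b, c, d] =
     (if i = 2 then
        (if a = b then [a, \<not> b, \<not> c, \<not> d]
         else if a then [\<not> a, \<not> b, \<not> c, \<not> d]
         else if c then [a, b, False, d] else [a, b, c, False])
      else if a \<noteq> b then
        (if (a = d) = (i = 0) then [a, \<not> b, c, d] else [\<not> a, b, c, d])
      else if (a = d) = (i = 0) then
        (if a then [\<not> a, \<not> b, \<not> c, \<not> d] else [a, b, False, d])
      else
        (if i = 0 then [a, b, c, \<not> d] else [a, b, \<not> c, \<not> d]))"
| "parent4 i v = v"

lemma augmented_cube_4_cist:
  "\<exists>T. completely_independent_spanning_trees (with_proj (augmented_cube 4)) 3 T"
proof -
  have "\<exists>T. completely_independent_spanning_trees (with_proj (augmented_cube 4))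
    (card {0, 1, 2 :: nat}) T"
  proof (rule augmented_cube_cist[where p = parent4 and colour = colour4 and m = 4
        and r = "\<lambda>i. [False, i = 2, False, i = 1]"], goal_cases)
    case (2 i v)
    then obtain a b c d where "v = [a, b, c, d]"
      by (auto simp: numeral_eq_Suc length_Suc_conv)
    with 2(1) show ?case
      by (cases a; cases b; cases c; cases d; auto simp: numeral_eq_Suc)
  next
    case (4 i j v)
    then obtain a b c d where "v = [a, b, c, d]"
      by (auto simp: numeral_eq_Suc length_Suc_conv)
    with 4(1-3) show ?case
      by (cases a; cases b; cases c; cases d; auto)
  qed auto
  then show ?thesis by (simp add: numeral_3_eq_3)
qed

fun colour5 :: "bool list \<Rightarrow> bool \<times> bool" where
  "colour5 [a, b, c, d, e] = (e, if a then b \<noteq> d else c)"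
| "colour5 _ = undefined"

text \<open>
  Flipping \<open>e\<close>, and flipping both \<open>c\<close> and \<open>d\<close>, generate a group of translations that permutes the
  four classes simply transitively.
  In class \<open>(x, y)\<close> the vertices with \<open>a = False\<close> form a 4-cycle in \<open>b\<close> and \<open>d\<close>. A vertex
  with \<open>a = True\<close> and \<open>c = y\<close> reaches this cycle by flipping \<open>a\<close>, and one with \<open>c \<noteq> y\<close> is brought
  to \<open>c = y\<close> by flipping \<open>c\<close>, on which the colour does not depend when \<open>a = True\<close>.

  Two classes that differ in \<open>x\<close> are joined by two disjoint perfect matchings, one for each of the
  two trees. If only \<open>x\<close> differs, one matching flips \<open>e\<close>; the other flips the last two bits when
  \<open>a = False\<close> and the last four when \<open>a = True\<close>. If \<open>y\<close> differs too, one matching flips the last three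
  bits; the other flips the last four when \<open>a = False\<close> and the last two when \<open>a = True\<close>.

  If only \<open>y\<close> differs, the vertices with \<open>a = True\<close> can flip either \<open>b\<close> or \<open>d\<close>, one of which serves
  each tree. A vertex with \<open>a = False\<close> can always flip \<open>c\<close>, and it can flip \<open>a\<close> when the resulting
  value of \<open>b \<noteq> d\<close> is \<open>y\<close>. As the two ends of an edge that flips \<open>c\<close> have the same \<open>b\<close> and \<open>d\<close>,
  exactly one of them can flip \<open>a\<close> instead, and leaves this edge to the other end.
\<close>
fun parent5 :: "bool \<times> bool \<Rightarrow> bool list \<Rightarrow> bool list" where
  "parent5 (x, y) [a, b, c, d, e] =
     (let q = (if a then b \<noteq> d else c) in
      if e = x \<and> q = y then
        (if a then (if c = y then [\<not> a, b, c, d, e] else [a, b, \<not> c, d, e])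
         else if b then [a, \<not> b, c, d, e] else [a, b, c, False, e])
      else if e = x then
        (if a then (if y then [a, \<not> b, c, d, e] else [a, b, c, \<not> d, e])
         else if (b \<noteq> d) = y then [\<not> a, b, c, d, e] else [a, b, \<not> c, d, e])
      else if q = y then
        (if \<not> x then [a, b, c, d, \<not> e]
         else if a then [a, \<not> b, \<not> c, \<not> d, \<not> e] else [a, b, c, \<not> d, \<not> e])
      else
        (if \<not> x then [a, b, \<not> c, \<not> d, \<not> e]
         else if a then [a, b, c, \<not> d, \<not> e] else [a, \<not> b, \<not> c, \<not> d, \<not> e]))"
| "parent5 i v = v"

lemma augmented_cube_5_cist:
  "\<exists>T. completely_independent_spanning_trees (with_proj (augmented_cube 5)) 4 T"
proof -
  have "\<exists>T. completely_independent_spanning_trees (with_proj (augmented_cube 5))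
    (card (UNIV :: (bool \<times> bool) set)) T"
  proof (rule augmented_cube_cist[where p = parent5 and colour = colour5 and m = 5
        and r = "\<lambda>(x, y). [False, False, y, False, x]"], goal_cases)
    case (2 i v)
    obtain x y where "i = (x, y)" by force
    moreover obtain a b c d e where "v = [a, b, c, d, e]"
      using 2 by (auto simp: numeral_eq_Suc length_Suc_conv)
    ultimately show ?case
      by (cases x; cases y; cases a; cases b; cases c; cases d; cases e; simp add: numeral_eq_Suc)
  next
    case (4 i j v)
    obtain x y x' y' where "i = (x, y)" "j = (x', y')" by force
    moreover obtain a b c d e where "v = [a, b, c, d, e]"
      using 4 by (auto simp: numeral_eq_Suc length_Suc_conv)
    ultimately show ?case
      using 4(3)
      by (cases x; cases y; cases x'; cases y'; cases a; cases b; cases c; cases d; cases e; simp)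
  qed auto
  moreover have "card (UNIV :: (bool \<times> bool) set) = 4"
    by (simp add: card_cartesian_product flip: UNIV_Times_UNIV)
  ultimately show ?thesis by simp
qed

theorem mainTheorem2:
  fixes n :: nat
  assumes "n \<in> {3, 4, 5}"
  shows "\<exists>T. completely_independent_spanning_trees (with_proj (augmented_cube n)) (n - 1) T"
  using assms augmented_cube_3_cist augmented_cube_4_cist augmented_cube_5_cist by auto

end
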